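(* Let $p$ be a prime and let $A\in SL_2(\mathbb{F}_p)$ be semisimple and diagonalizable over $\mathbb{F}_p$, with eigenvalues $\lambda_1,\lambda_2\in\mathbb{F}_p$ both of which are non-squares in $\mathbb{F}_p$, i.e. $\left(\frac{\lambda_1}{p}\right)=\left(\frac{\lambda_2}{p}\right)=-1$. Then there exists $M\in SL_2(\mathbb{F}_p)$ with $M^2=A$ if and only if $A$ is similar to a scalar matrix.
   Context: A matrix is semisimple if its minimal polynomial is a product of distinct monic irreducible separable polynomials. $\left(\frac{\cdot}{p}\right)$ is the Legendre symbol. A scalar matrix is a matrix $dE$ with $d\in\mathbb{F}_p$, $E$ the identity matrix. *)

theory Defs
  imports
    "HOL-Number_Theory.Residues"
    "Jordan_Normal_Form.Spectral_Radius"
    "Berlekamp_Zassenhaus.Finite_Field_Factorization"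
begin

definition special_linear :: "nat \<Rightarrow> 'a :: comm_ring_1 mat set" where
  "special_linear n = {A \<in> carrier_mat n n. det A = 1}"

text \<open>The value \<open>p(A) = \<Sum>k. coeff p k * A ^ k\<close> of a polynomial at a square matrix, entry by
  entry: matrices of unspecified dimension have no neutral element for addition, hence no \<open>sum\<close>.\<close>

definition eval_poly_mat :: "'a :: comm_ring_1 poly \<Rightarrow> 'a mat \<Rightarrow> 'a mat" where
  "eval_poly_mat p A = mat (dim_row A) (dim_row A)
     (\<lambda>ij. \<Sum>k\<le>degree p. coeff p k * (A ^\<^sub>m k) $$ ij)"

definition annihilates :: "'a :: comm_ring_1 poly \<Rightarrow> 'a mat \<Rightarrow> bool" where
  "annihilates p A \<longleftrightarrow> eval_poly_mat p A = 0\<^sub>m (dim_row A) (dim_row A)"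

definition is_minimal_poly :: "'a :: field mat \<Rightarrow> 'a poly \<Rightarrow> bool" where
  "is_minimal_poly A p \<longleftrightarrow> monic p \<and> annihilates p A \<and>
     (\<forall>q. q \<noteq> 0 \<and> annihilates q A \<longrightarrow> degree p \<le> degree q)"

definition semisimple_mat :: "'a :: field mat \<Rightarrow> bool" where
  "semisimple_mat A \<longleftrightarrow> square_mat A \<and>
     (\<exists>S. finite S \<and> (\<forall>f\<in>S. monic f \<and> irreducible f \<and> separable f) \<and>
          is_minimal_poly A (\<Prod>f\<in>S. f))"

definition diagonalizable_mat :: "'a :: comm_ring_1 mat \<Rightarrow> bool" where
  "diagonalizable_mat A \<longleftrightarrow> (\<exists>D. diagonal_mat D \<and> similar_mat A D)"

definition scalar_mat :: "nat \<Rightarrow> 'a :: comm_ring_1 mat \<Rightarrow> bool" where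
  "scalar_mat n A \<longleftrightarrow> (\<exists>d. A = d \<cdot>\<^sub>m 1\<^sub>m n)"

end

theory Submission
  imports Defs
begin

text \<open>Cayley--Hamilton gives \<open>A = M\<^sup>2 = t M - E\<close> with \<open>t\<close> the trace of \<open>M\<close>. If \<open>t = 0\<close> then \<open>A = -E\<close>;
  otherwise the characteristic equation of \<open>A\<close>, whose trace is \<open>t\<^sup>2 - 2\<close>, shows that every eigenvalue
  \<open>l\<close> satisfies \<open>t\<^sup>2 l = (l + 1)\<^sup>2\<close> and hence is a square. Conversely, a scalar matrix of determinant
  1 with non-square eigenvalue is \<open>-E\<close>, the square of the rotation by a right angle.\<close>

text \<open>The representative of \<open>x\<^sup>2\<close> is congruent modulo the field size to the
  square of the representative of \<open>x\<close>, hence a quadratic residue or zero. This turns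
  the Legendre hypothesis on integers into a statement about squares in the field.\<close>

lemma Legendre_to_int_mod_ring_square:
  fixes x :: "'p :: prime_card mod_ring"
  shows "Legendre (to_int_mod_ring (x\<^sup>2)) (int CARD('p)) \<noteq> -1"
proof -
  have "to_int_mod_ring (x\<^sup>2) = (to_int_mod_ring x)\<^sup>2 mod int CARD('p)"
    unfolding power2_eq_square by transfer simp
  then have "QuadRes (int CARD('p)) (to_int_mod_ring (x\<^sup>2))"
    unfolding QuadRes_def by (metis cong_mod_right cong_refl)
  then show ?thesis
    by (simp add: Legendre_def)
qed

lemma det_2:
  fixes A :: "'a :: comm_ring_1 mat"
  assumes A: "A \<in> carrier_mat 2 2"
  shows "det A = A $$ (0,0) * A $$ (1,1) - A $$ (0,1) * A $$ (1,0)"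
proof -
  \<comment> \<open>For \<open>i < 2\<close> the number \<open>1 - i\<close> is the index of the row
    that survives the deletion.\<close>
  have "det (mat_delete A i 0) = A $$ (1 - i, 1)" if "i < 2" for i
  proof -
    have "mat_delete A i 0 \<in> carrier_mat 1 1"
      using mat_delete_carrier[of A 2 2] A by simp
    then show ?thesis
      using that A by (auto simp: det_single mat_delete_def less_2_cases_iff)
  qed
  moreover have "det A = (\<Sum>i<2. A $$ (i,0) * cofactor A i 0)"
    using laplace_expansion_column[OF A] by simp
  ultimately show ?thesis
    by (simp add: numeral_2_eq_2 cofactor_def)
qed

lemma eigenvalue_2_iff:
  fixes A :: "'a :: field mat"
  assumes "A \<in> carrier_mat 2 2"
  shows "eigenvalue A l \<longleftrightarrow> l\<^sup>2 - (A $$ (0,0) + A $$ (1,1)) * l + det A = 0"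
proof -
  have "char_matrix A l \<in> carrier_mat 2 2"
    using assms by simp
  then have "det (char_matrix A l) = l\<^sup>2 - (A $$ (0,0) + A $$ (1,1)) * l + det A"
    using assms by (simp add: det_2 char_matrix_def power2_eq_square algebra_simps)
  then show ?thesis
    using eigenvalue_det[OF assms] by simp
qed

lemma mat_eq_2I:
  assumes "A \<in> carrier_mat 2 2" "B \<in> carrier_mat 2 2"
    and "A $$ (0,0) = B $$ (0,0)" "A $$ (0,1) = B $$ (0,1)"
    and "A $$ (1,0) = B $$ (1,0)" "A $$ (1,1) = B $$ (1,1)"
  shows "A = B"
  using assms by (intro eq_matI) (auto simp: less_2_cases_iff)

lemma pow_mat_2_index:
  fixes M :: "'a :: comm_semiring_1 mat"
  assumes "M \<in> carrier_mat 2 2" "i < 2" "j < 2"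
  shows "(M ^\<^sub>m 2) $$ (i,j) = M $$ (i,0) * M $$ (0,j) + M $$ (i,1) * M $$ (1,j)"
  using assms by (simp add: numeral_2_eq_2 scalar_prod_def)

lemma Cayley_Hamilton_2:
  fixes M :: "'a :: comm_ring_1 mat"
  assumes "M \<in> special_linear 2"
  shows "M ^\<^sub>m 2 = (M $$ (0,0) + M $$ (1,1)) \<cdot>\<^sub>m M - 1\<^sub>m 2"
proof -
  have M: "M \<in> carrier_mat 2 2" and "det M = 1"
    using assms by (auto simp: special_linear_def)
  \<comment> \<open>Solved for the off-diagonal product, the only term in the diagonal entries of
    the square that has to be eliminated.\<close>
  then have "M $$ (0,1) * M $$ (1,0) = M $$ (0,0) * M $$ (1,1) - 1"
    by (auto simp: det_2 algebra_simps)
  then show ?thesis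
    using M by (intro mat_eq_2I) (auto simp: pow_mat_2_index algebra_simps)
qed

text \<open>Stated without division so that it covers trace zero as well; for nonzero trace it
  exhibits \<open>l\<close> as a square.\<close>

lemma eigenvalue_square_SL2:
  fixes M :: "'a :: field mat"
  assumes M: "M \<in> special_linear 2" and l: "eigenvalue (M ^\<^sub>m 2) l"
  shows "(M $$ (0,0) + M $$ (1,1))\<^sup>2 * l = (l + 1)\<^sup>2"
proof -
  define t where "t = M $$ (0,0) + M $$ (1,1)"
  have C: "M \<in> carrier_mat 2 2" and "det M = 1"
    using M by (auto simp: special_linear_def)
  then have "det (M ^\<^sub>m 2) = 1"
    by (simp add: numeral_2_eq_2 det_mult)
  moreover have "(M ^\<^sub>m 2) $$ (0,0) + (M ^\<^sub>m 2) $$ (1,1) = t\<^sup>2 - 2"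
    using C by (simp add: Cayley_Hamilton_2[OF M] t_def power2_eq_square algebra_simps)
  ultimately have "l\<^sup>2 - (t\<^sup>2 - 2) * l + 1 = 0"
    using l C by (simp add: eigenvalue_2_iff)
  then show ?thesis
    unfolding t_def[symmetric] by (simp add: power2_eq_square algebra_simps)
qed

text \<open>Scalar matrices are central, so conjugation fixes them and the similarity class of one
  is a singleton.\<close>

lemma similar_mat_scalar_iff:
  "(\<exists>B. scalar_mat n B \<and> similar_mat A B) \<longleftrightarrow> scalar_mat n A"
proof
  assume "\<exists>B. scalar_mat n B \<and> similar_mat A B"
  then obtain d where "similar_mat A (d \<cdot>\<^sub>m 1\<^sub>m n)"
    unfolding scalar_mat_def by blast
  from similar_matD[OF this] obtain m P Q
    where carr: "{A, d \<cdot>\<^sub>m 1\<^sub>m n, P, Q} \<subseteq> carrier_mat m m"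
      and PQ: "P * Q = 1\<^sub>m m" and A: "A = P * (d \<cdot>\<^sub>m 1\<^sub>m n) * Q"
    by (elim exE conjE)
  have "m = n" and P: "P \<in> carrier_mat n n" and Q: "Q \<in> carrier_mat n n"
    using carr by auto
  have "A = d \<cdot>\<^sub>m (P * Q)"
    using P by (simp add: A mult_smult_distrib[OF P one_carrier_mat] mult_smult_assoc_mat[OF P Q])
  then show "scalar_mat n A"
    using PQ \<open>m = n\<close> unfolding scalar_mat_def by auto
next
  assume "scalar_mat n A"
  then have "similar_mat A A"
    unfolding scalar_mat_def by (auto intro!: similar_mat_refl[of _ n])
  then show "\<exists>B. scalar_mat n B \<and> similar_mat A B"
    using \<open>scalar_mat n A\<close> by blast
qed

theorem theorem23:
  fixes p :: nat
    and A :: "'p :: prime_card mod_ring mat"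
    and l1 l2 :: "'p mod_ring"
  assumes "prime p" and "CARD('p) = p"
    and "A \<in> special_linear 2"
    and "semisimple_mat A"
    and "diagonalizable_mat A"
    and "spectrum A = {l1, l2}"
    and "Legendre (to_int_mod_ring l1) (int p) = -1"
    and "Legendre (to_int_mod_ring l2) (int p) = -1"
  shows "(\<exists>M \<in> special_linear 2. M ^\<^sub>m 2 = A) \<longleftrightarrow> (\<exists>B. scalar_mat 2 B \<and> similar_mat A B)"
  unfolding similar_mat_scalar_iff
proof
  \<comment> \<open>A square with Legendre symbol -1 is impossible; both directions get their
    contradiction from here.\<close>
  have nonsquare: "l1 \<noteq> x\<^sup>2" for x
    using Legendre_to_int_mod_ring_square[of x] assms(2,7) by auto
  have l1: "eigenvalue A l1"
    using assms(6) by (auto simp: spectrum_def)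
  {
    assume "\<exists>M \<in> special_linear 2. M ^\<^sub>m 2 = A"
    then obtain M where M: "M \<in> special_linear 2" "M ^\<^sub>m 2 = A"
      by blast
    define t where "t = M $$ (0,0) + M $$ (1,1)"
    have C: "M \<in> carrier_mat 2 2"
      using M by (simp add: special_linear_def)
    have eq: "t\<^sup>2 * l1 = (l1 + 1)\<^sup>2"
      using eigenvalue_square_SL2[OF M(1)] M(2) l1 by (simp add: t_def)
    have "t = 0"
    proof (rule ccontr)
      assume "t \<noteq> 0"
      then have "l1 = ((l1 + 1) / t)\<^sup>2"
        using eq by (simp add: power_divide field_simps)
      then show False
        using nonsquare by blast
    qed
    then have "A = (- 1) \<cdot>\<^sub>m 1\<^sub>m 2"
      using Cayley_Hamilton_2[OF M(1)] M(2) C by (intro mat_eq_2I) (auto simp: t_def)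
    then show "scalar_mat 2 A"
      by (auto simp: scalar_mat_def)
  next
    assume "scalar_mat 2 A"
    then obtain d where A: "A = d \<cdot>\<^sub>m 1\<^sub>m 2"
      by (auto simp: scalar_mat_def)
    then have "d\<^sup>2 = 1"
      using assms(3) by (simp add: special_linear_def)
    \<comment> \<open>The characteristic polynomial of \<open>A\<close> is the square of X - d,
      which identifies \<open>l1\<close> with \<open>d\<close> and makes \<open>d\<close> a
      non-square.\<close>
    have "l1\<^sup>2 - (d + d) * l1 + d\<^sup>2 = 0"
      using l1 by (simp add: A eigenvalue_2_iff)
    then have "(l1 - d)\<^sup>2 = 0"
      by (simp add: power2_eq_square algebra_simps)
    then have "l1 = d"
      by simp
    then have "d \<noteq> 1"
      using nonsquare[of 1] by simp
    then have d: "d = -1"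
      using \<open>d\<^sup>2 = 1\<close> by (simp add: power2_eq_1_iff)
    \<comment> \<open>The companion matrix of X^2 + 1: it has determinant 1 and the trace zero that
      the other direction forces on every root.\<close>
    define M :: "'p mod_ring mat" where "M = mat_of_rows_list 2 [[0, 1], [-1, 0]]"
    have C: "M \<in> carrier_mat 2 2"
      by (simp add: M_def mat_of_rows_list_def numeral_2_eq_2)
    have idx: "M $$ (0,0) = 0" "M $$ (0,1) = 1" "M $$ (1,0) = -1" "M $$ (1,1) = 0"
      by (simp_all add: M_def mat_of_rows_list_def)
    have SL: "M \<in> special_linear 2"
      using C idx by (simp add: special_linear_def det_2)
    have "M ^\<^sub>m 2 = A"
      using C idx by (intro mat_eq_2I) (auto simp: A d pow_mat_2_index)
    with SL show "\<exists>M \<in> special_linear 2. M ^\<^sub>m 2 = A"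
      by blast
  }
qed

end
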